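(* In the metric estimation problem described in the context, let $C_n(r)=\max_{x\in A_n}\mathbb P_{post}(B(x,r))$ for $r\ge0$. Then: (1) partial estimation is feasible if and only if, for some $0\le r<1$, $C_n(r)\to1$ in probability; (2) almost exact estimation is feasible if and only if, for any $\varepsilon>0$, $C_n(\varepsilon)\to1$ in probability; (3) partial estimation is intractable if and only if, for any $0\le r<1$, $C_n(r)\to0$ in probability; (4) almost exact estimation is intractable if and only if, for some $\varepsilon>0$, $C_n(\varepsilon)\to0$ in probability. All limits are as $n\to\infty$.
   Context: Metric estimation problem: for each $n$, $(A_n,d=d_n,\mu=\mu_n)$ is a metric space of diameter $1$ equipped with a (prior) probability distribution; $B_n$ is a measurable space equipped with probability distributions $(\nu_x)_{x\in A_n}$ such that $x\mapsto\nu_x$ is measurable. $X_n\in A_n$ is a random variable with law $\mu_n$ and, given $X_n$, $Y_n\in B_n$ has law $\nu_{X_n}$. For measurable $S\subseteq A_n$, $\mathbb P_{post}(S)=\mathbb P(X_n\in S\mid Y_n)$. $B(x,r)$ is the closed ball of radius $r$ centred at $x$. It is assumed that the maximum defining $C_n(r)$ is attained at some point depending measurably on $Y_n$. An estimator $\hat X_n$ is a $Y_n$-measurable random variable with values in $A_n$. Write $l_r(x,x')=\mathbf 1_{d(x,x')>r}$. Definitions. Partial estimation is feasible if there exist $0\le r<1$ and a sequence of estimators with $\mathbb E[l_r(\hat X_n,X_n)]\to0$. Partial estimation is intractable if for every $0\le r<1$ and every sequence of estimators, $\mathbb E[l_r(\hat X_n,X_n)]\to1$. Almost exact estimation is feasible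 if there exists a sequence of estimators such that for every $\varepsilon>0$, $\mathbb E[l_\varepsilon(\hat X_n,X_n)]\to0$. Almost exact estimation is intractable if there is $\varepsilon>0$ such that for every sequence of estimators, $\mathbb E[l_\varepsilon(\hat X_n,X_n)]\to1$. *)

theory Defs
  imports "HOL-Probability.Probability"
begin

definition sigma_gen :: "'w measure \<Rightarrow> 'b measure \<Rightarrow> ('w \<Rightarrow> 'b) \<Rightarrow> 'w measure" where
  "sigma_gen \<Omega> N Z = vimage_algebra (space \<Omega>) Z N"

text \<open>\<open>K\<close> is a regular version of the conditional distribution of the \<open>N\<close>-valued random variable
  \<open>Z\<close> given the sub-algebra \<open>F\<close>: a random probability measure, measurable with respect to \<open>F\<close>,
  such that \<open>K(S) = P(Z \<in> S | F)\<close> almost surely for every measurable \<open>S\<close>.\<close>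

definition regular_cond_dist ::
    "'w measure \<Rightarrow> 'w measure \<Rightarrow> 'c measure \<Rightarrow> ('w \<Rightarrow> 'c) \<Rightarrow> ('w \<Rightarrow> 'c measure) \<Rightarrow> bool" where
  "regular_cond_dist \<Omega> F N Z K \<longleftrightarrow>
     K \<in> F \<rightarrow>\<^sub>M prob_algebra N \<and>
     (\<forall>S\<in>sets N. AE \<omega> in \<Omega>.
        measure (K \<omega>) S = real_cond_exp \<Omega> F (\<lambda>\<omega>'. indicat_real S (Z \<omega>')) \<omega>)"

definition estimator ::
    "'w measure \<Rightarrow> 'b measure \<Rightarrow> ('w \<Rightarrow> 'b) \<Rightarrow> 'a measure \<Rightarrow> ('w \<Rightarrow> 'a) \<Rightarrow> bool" where
  "estimator \<Omega> B Y \<mu> xh \<longleftrightarrow> xh \<in> sigma_gen \<Omega> B Y \<rightarrow>\<^sub>M \<mu>"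

definition max_post :: "'a set \<Rightarrow> ('a \<Rightarrow> 'a \<Rightarrow> real) \<Rightarrow> 'a measure \<Rightarrow> real \<Rightarrow> real" where
  "max_post A d p r = (SUP x\<in>A. measure p (Metric_space.mcball A d x r))"

text \<open>The estimation problem for a single \<open>n\<close>. The prior \<open>\<mu>\<close> carries the sigma-algebra of \<open>A\<close>.
  It is only required to make the distance jointly measurable, so that closed balls and the events
  \<open>d (xh, X) > r\<close> are measurable; the Borel algebra of a separable metric satisfies this.
  \<open>post\<close> is the posterior, as a random measure on the sample space. The supremum over infinite
  \<open>A\<close> in \<open>max_post\<close> depends on the choice of versions of \<open>P(X \<in> S | Y)\<close>, hence the
  posterior is a fixed regular version; \<open>max_attained\<close> makes that supremum a maximum.\<close>

locale metric_estimation = Metric_space A d + prob_space \<Omega>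
  for A :: "'a set" and d :: "'a \<Rightarrow> 'a \<Rightarrow> real" and \<Omega> :: "'w measure" +
  fixes \<mu> :: "'a measure" and B :: "'b measure" and \<nu> :: "'a \<Rightarrow> 'b measure"
    and X :: "'w \<Rightarrow> 'a" and Y :: "'w \<Rightarrow> 'b" and post :: "'w \<Rightarrow> 'a measure"
  assumes diameter: "(SUP p\<in>A \<times> A. ereal (d (fst p) (snd p))) = 1"
    and prior: "prob_space \<mu>" "space \<mu> = A"
    and dist_measurable: "(\<lambda>p. d (fst p) (snd p)) \<in> borel_measurable (\<mu> \<Otimes>\<^sub>M \<mu>)"
    and kernel: "\<nu> \<in> \<mu> \<rightarrow>\<^sub>M prob_algebra B"
    and X: "X \<in> \<Omega> \<rightarrow>\<^sub>M \<mu>" "distr \<Omega> \<mu> X = \<mu>"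
    and Y: "Y \<in> \<Omega> \<rightarrow>\<^sub>M B" "regular_cond_dist \<Omega> (sigma_gen \<Omega> \<mu> X) B Y (\<lambda>\<omega>. \<nu> (X \<omega>))"
    and posterior: "regular_cond_dist \<Omega> (sigma_gen \<Omega> B Y) \<mu> X post"
    and max_attained: "\<And>r. 0 \<le> r \<Longrightarrow> \<exists>xs. estimator \<Omega> B Y \<mu> xs \<and>
      (\<forall>\<omega>\<in>space \<Omega>. \<forall>x\<in>A. measure (post \<omega>) (mcball x r) \<le> measure (post \<omega>) (mcball (xs \<omega>) r))"

definition loss :: "('a \<Rightarrow> 'a \<Rightarrow> real) \<Rightarrow> real \<Rightarrow> 'a \<Rightarrow> 'a \<Rightarrow> real" where
  "loss d r x x' = of_bool (d x x' > r)"

definition risk ::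
    "('a \<Rightarrow> 'a \<Rightarrow> real) \<Rightarrow> 'w measure \<Rightarrow> ('w \<Rightarrow> 'a) \<Rightarrow> real \<Rightarrow> ('w \<Rightarrow> 'a) \<Rightarrow> real" where
  "risk d \<Omega> X r xh = (\<integral>\<omega>. loss d r (xh \<omega>) (X \<omega>) \<partial>\<Omega>)"

definition tends_in_prob :: "(nat \<Rightarrow> 'w measure) \<Rightarrow> (nat \<Rightarrow> 'w \<Rightarrow> real) \<Rightarrow> real \<Rightarrow> bool" where
  "tends_in_prob \<Omega> Z c \<longleftrightarrow>
     (\<forall>\<delta>>0. (\<lambda>n. measure (\<Omega> n) {\<omega> \<in> space (\<Omega> n). \<bar>Z n \<omega> - c\<bar> > \<delta>}) \<longlonglongrightarrow> 0)"

definition estimator_seq ::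
    "(nat \<Rightarrow> 'w measure) \<Rightarrow> (nat \<Rightarrow> 'b measure) \<Rightarrow> (nat \<Rightarrow> 'w \<Rightarrow> 'b) \<Rightarrow> (nat \<Rightarrow> 'a measure)
      \<Rightarrow> (nat \<Rightarrow> 'w \<Rightarrow> 'a) \<Rightarrow> bool" where
  "estimator_seq \<Omega> B Y \<mu> xh \<longleftrightarrow> (\<forall>n. estimator (\<Omega> n) (B n) (Y n) (\<mu> n) (xh n))"

definition partial_feasible ::
    "(nat \<Rightarrow> 'a \<Rightarrow> 'a \<Rightarrow> real) \<Rightarrow> (nat \<Rightarrow> 'w measure) \<Rightarrow> (nat \<Rightarrow> 'a measure) \<Rightarrow> (nat \<Rightarrow> 'b measure)
      \<Rightarrow> (nat \<Rightarrow> 'w \<Rightarrow> 'a) \<Rightarrow> (nat \<Rightarrow> 'w \<Rightarrow> 'b) \<Rightarrow> bool" where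
  "partial_feasible d \<Omega> \<mu> B X Y \<longleftrightarrow>
     (\<exists>r xh. 0 \<le> r \<and> r < 1 \<and> estimator_seq \<Omega> B Y \<mu> xh \<and>
       (\<lambda>n. risk (d n) (\<Omega> n) (X n) r (xh n)) \<longlonglongrightarrow> 0)"

definition partial_intractable ::
    "(nat \<Rightarrow> 'a \<Rightarrow> 'a \<Rightarrow> real) \<Rightarrow> (nat \<Rightarrow> 'w measure) \<Rightarrow> (nat \<Rightarrow> 'a measure) \<Rightarrow> (nat \<Rightarrow> 'b measure)
      \<Rightarrow> (nat \<Rightarrow> 'w \<Rightarrow> 'a) \<Rightarrow> (nat \<Rightarrow> 'w \<Rightarrow> 'b) \<Rightarrow> bool" where
  "partial_intractable d \<Omega> \<mu> B X Y \<longleftrightarrow>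
     (\<forall>r xh. 0 \<le> r \<longrightarrow> r < 1 \<longrightarrow> estimator_seq \<Omega> B Y \<mu> xh \<longrightarrow>
       (\<lambda>n. risk (d n) (\<Omega> n) (X n) r (xh n)) \<longlonglongrightarrow> 1)"

definition almost_exact_feasible ::
    "(nat \<Rightarrow> 'a \<Rightarrow> 'a \<Rightarrow> real) \<Rightarrow> (nat \<Rightarrow> 'w measure) \<Rightarrow> (nat \<Rightarrow> 'a measure) \<Rightarrow> (nat \<Rightarrow> 'b measure)
      \<Rightarrow> (nat \<Rightarrow> 'w \<Rightarrow> 'a) \<Rightarrow> (nat \<Rightarrow> 'w \<Rightarrow> 'b) \<Rightarrow> bool" where
  "almost_exact_feasible d \<Omega> \<mu> B X Y \<longleftrightarrow>
     (\<exists>xh. estimator_seq \<Omega> B Y \<mu> xh \<and>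
       (\<forall>\<epsilon>>0. (\<lambda>n. risk (d n) (\<Omega> n) (X n) \<epsilon> (xh n)) \<longlonglongrightarrow> 0))"

definition almost_exact_intractable ::
    "(nat \<Rightarrow> 'a \<Rightarrow> 'a \<Rightarrow> real) \<Rightarrow> (nat \<Rightarrow> 'w measure) \<Rightarrow> (nat \<Rightarrow> 'a measure) \<Rightarrow> (nat \<Rightarrow> 'b measure)
      \<Rightarrow> (nat \<Rightarrow> 'w \<Rightarrow> 'a) \<Rightarrow> (nat \<Rightarrow> 'w \<Rightarrow> 'b) \<Rightarrow> bool" where
  "almost_exact_intractable d \<Omega> \<mu> B X Y \<longleftrightarrow>
     (\<exists>\<epsilon>>0. \<forall>xh. estimator_seq \<Omega> B Y \<mu> xh \<longrightarrow>
       (\<lambda>n. risk (d n) (\<Omega> n) (X n) \<epsilon> (xh n)) \<longlonglongrightarrow> 1)"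

end

theory Submission
  imports Defs
begin

text \<open>Disintegrating the joint law of \<open>(Y, X)\<close> along the posterior gives
  \<open>1 - risk r xh = E (post (B (xh, r)))\<close>. Hence the estimator attaining the maximum has the
  smallest risk, namely \<open>1 - E (C r)\<close>, and since \<open>0 \<le> C r \<le> 1\<close>, convergence of \<open>E (C r)\<close> to 0 or 1
  is convergence of \<open>C r\<close> in probability. Almost exact estimation needs one sequence of estimators for
  all \<open>\<epsilon>\<close>; it comes from a diagonal choice of radii \<open>\<epsilon> n\<close> tending to 0.\<close>

section \<open>Convergence in probability of bounded variables\<close>

text \<open>Markov's inequality bounds the deviation probability by the mean deviation. Conversely,
  cutting at level \<delta> bounds the mean by \<delta> plus the probability of exceeding \<delta>,
  because \<open>le1\<close> caps the deviation by 1. Variables with values in [0,1] meet this cap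
  for both limits of interest, 0 and 1.\<close>

lemma tends_in_prob_iff_integral_tendsto:
  fixes Z :: "nat \<Rightarrow> 'w \<Rightarrow> real"
  assumes P: "\<And>n. prob_space (\<Omega> n)"
    and Z: "\<And>n. Z n \<in> borel_measurable (\<Omega> n)"
    and le1: "\<And>n \<omega>. \<omega> \<in> space (\<Omega> n) \<Longrightarrow> \<bar>Z n \<omega> - c\<bar> \<le> 1"
  shows "tends_in_prob \<Omega> Z c \<longleftrightarrow> (\<lambda>n. \<integral>\<omega>. \<bar>Z n \<omega> - c\<bar> \<partial>\<Omega> n) \<longlonglongrightarrow> 0"
proof -
  define E where "E n = (\<integral>\<omega>. \<bar>Z n \<omega> - c\<bar> \<partial>\<Omega> n)" for n
  define p where "p \<delta> n = measure (\<Omega> n) {\<omega> \<in> space (\<Omega> n). \<bar>Z n \<omega> - c\<bar> > \<delta>}" for \<delta> n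
  note Z [measurable]
  have int: "integrable (\<Omega> n) (\<lambda>\<omega>. \<bar>Z n \<omega> - c\<bar>)" for n
  proof -
    interpret prob_space "\<Omega> n" by (rule P)
    show ?thesis
      by (rule integrable_const_bound[where B=1]) (auto intro!: AE_I2 le1)
  qed
  have E_nonneg: "0 \<le> E n" for n
    unfolding E_def by simp
  have markov: "\<delta> * p \<delta> n \<le> E n" if "\<delta> > 0" for \<delta> n
  proof -
    interpret prob_space "\<Omega> n" by (rule P)
    \<comment> \<open>Markov's inequality concerns the non-strict event, which contains the strict
      one.\<close>
    have "p \<delta> n \<le> prob {\<omega> \<in> space (\<Omega> n). \<bar>Z n \<omega> - c\<bar> \<ge> \<delta>}"
      unfolding p_def by (rule finite_measure_mono) auto
    also have "\<dots> \<le> E n / \<delta>"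
      unfolding E_def by (rule integral_Markov_inequality_measure[where A="{}"])
        (use int that in auto)
    finally show ?thesis
      using that by (simp add: field_simps)
  qed
  have upper: "E n \<le> \<delta> + p \<delta> n" if "\<delta> > 0" for \<delta> n
  proof -
    interpret prob_space "\<Omega> n" by (rule P)
    let ?S = "{\<omega> \<in> space (\<Omega> n). \<bar>Z n \<omega> - c\<bar> > \<delta>}"
    have S: "?S \<in> sets (\<Omega> n)" by measurable
    have "E n \<le> (\<integral>\<omega>. \<delta> + indicat_real ?S \<omega> \<partial>\<Omega> n)"
      unfolding E_def
    proof (rule integral_mono)
      show "integrable (\<Omega> n) (\<lambda>\<omega>. \<delta> + indicat_real ?S \<omega>)"
        using S by (auto simp: less_top[symmetric])
      show "\<bar>Z n \<omega> - c\<bar> \<le> \<delta> + indicat_real ?S \<omega>" if "\<omega> \<in> space (\<Omega> n)" for \<omega>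
        using le1[OF that] \<open>\<delta> > 0\<close> that by (auto simp: indicator_def)
    qed (rule int)
    also have "\<dots> = \<delta> + p \<delta> n"
      using S by (subst Bochner_Integration.integral_add)
        (auto simp: p_def prob_space less_top[symmetric])
    finally show ?thesis .
  qed
  have "(\<forall>\<delta>>0. p \<delta> \<longlonglongrightarrow> 0) \<longleftrightarrow> E \<longlonglongrightarrow> 0"
  proof (intro iffI allI impI)
    fix \<delta> :: real
    assume E0: "E \<longlonglongrightarrow> 0" and "\<delta> > 0"
    have "(\<lambda>n. E n / \<delta>) \<longlonglongrightarrow> 0"
      using tendsto_divide[OF E0 tendsto_const[of \<delta>]] \<open>\<delta> > 0\<close> by simp
    then show "p \<delta> \<longlonglongrightarrow> 0"
    proof (rule tendsto_sandwich[OF _ _ tendsto_const, rotated 2])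
      show "\<forall>\<^sub>F n in sequentially. p \<delta> n \<le> E n / \<delta>"
        using markov[OF \<open>\<delta> > 0\<close>] \<open>\<delta> > 0\<close> by (simp add: field_simps)
    qed (simp add: p_def)
  next
    assume p0: "\<forall>\<delta>>0. p \<delta> \<longlonglongrightarrow> 0"
    show "E \<longlonglongrightarrow> 0"
    proof (rule order_tendstoI)
      fix a :: real
      assume "a < 0"
      then show "\<forall>\<^sub>F n in sequentially. a < E n"
        by (intro always_eventually allI) (rule less_le_trans[OF _ E_nonneg])
    next
      fix a :: real
      assume "0 < a"
      \<comment> \<open>One half of \<open>a\<close> pays for the cut-off level in
        \<open>upper\<close>, the other half for the probability of exceeding it.\<close>
      then have "\<forall>\<^sub>F n in sequentially. p (a/2) n < a/2"
        using p0 by (intro order_tendstoD(2)[of "p (a/2)" 0]) auto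
      then show "\<forall>\<^sub>F n in sequentially. E n < a"
      proof eventually_elim
        case (elim n)
        then show ?case
          using upper[of "a/2" n] \<open>0 < a\<close> by simp
      qed
    qed
  qed
  then show ?thesis
    unfolding tends_in_prob_def p_def E_def .
qed

section \<open>Disintegration along a regular conditional distribution\<close>

text \<open>The definition of \<open>regular_cond_dist\<close> speaks of one fixed set at a time,
  with an exceptional null set depending on it, whereas the ball around an estimate moves with the
  sample point. Dynkin's argument bridges the gap: on rectangles the identity is the averaging
  property of conditional expectation, rectangles form an intersection-stable generator, and the
  identity passes to complements and disjoint countable unions. Taking \<open>F\<close> as the
  algebra of the first coordinate restricts the moving sets to those determined by the conditioning
  information.\<close>

lemma (in prob_space) emeasure_graph_regular_cond_dist:
  assumes sub: "subalgebra M F"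
    and Z: "Z \<in> M \<rightarrow>\<^sub>M N"
    and K: "regular_cond_dist M F N Z K"
    and S: "S \<in> sets (F \<Otimes>\<^sub>M N)"
  shows "emeasure M {\<omega> \<in> space M. (\<omega>, Z \<omega>) \<in> S} = (\<integral>\<^sup>+\<omega>. emeasure (K \<omega>) (Pair \<omega> -` S) \<partial>M)"
proof -
  interpret finite_measure_subalgebra M F
    by unfold_locales (rule sub)
  have space_F: "space F = space M"
    using sub by (simp add: subalgebra_def)
  have Kmeas: "K \<in> F \<rightarrow>\<^sub>M prob_algebra N"
    using K by (simp add: regular_cond_dist_def)
  have Kprob: "prob_space (K \<omega>)" and Ksets: "sets (K \<omega>) = sets N" if "\<omega> \<in> space M" for \<omega>
    using measurable_space[OF Kmeas, of \<omega>] that by (auto simp: space_prob_algebra space_F)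
  \<comment> \<open>The identity is measurable from \<open>M\<close> into the coarser algebra
    \<open>F\<close>.\<close>
  have graph: "(\<lambda>\<omega>. (\<omega>, Z \<omega>)) \<in> M \<rightarrow>\<^sub>M F \<Otimes>\<^sub>M N"
    using Z measurable_from_subalg[OF sub measurable_ident_sets[OF refl]]
    by (rule measurable_Pair[rotated])
  have meas_slice: "(\<lambda>\<omega>. emeasure (K \<omega>) (Pair \<omega> -` T)) \<in> borel_measurable M"
    if "T \<in> sets (F \<Otimes>\<^sub>M N)" for T
  proof (rule measurable_from_subalg[OF sub], rule emeasure_measurable_subprob_algebra2)
    \<comment> \<open>The measurability rule for random measures expects the set as the disjoint sum
      of its sections.\<close>
    have "(SIGMA \<omega>:space F. Pair \<omega> -` T) = T"
      using sets.sets_into_space[OF that] by (auto simp: space_pair_measure)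
    then show "(SIGMA \<omega>:space F. Pair \<omega> -` T) \<in> sets (F \<Otimes>\<^sub>M N)"
      using that by simp
    show "K \<in> F \<rightarrow>\<^sub>M subprob_algebra N"
      by (rule measurable_prob_algebraD[OF Kmeas])
  qed
  have slice: "Pair \<omega> -` T \<in> sets (K \<omega>)" if "T \<in> sets (F \<Otimes>\<^sub>M N)" "\<omega> \<in> space M" for T \<omega>
    using sets_Pair1[OF that(1)] Ksets[OF that(2)] by simp
  have event: "{\<omega> \<in> space M. (\<omega>, Z \<omega>) \<in> T} \<in> sets M" if "T \<in> sets (F \<Otimes>\<^sub>M N)" for T
    using measurable_sets[OF graph that] by (simp add: vimage_def Int_def conj_commute)
  let ?G = "{a \<times> b | a b. a \<in> sets F \<and> b \<in> sets N}"
  have sets_eq: "sets (F \<Otimes>\<^sub>M N) = sigma_sets (space F \<times> space N) ?G"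
    by (rule sets_pair_measure)
  have "?G \<subseteq> Pow (space F \<times> space N)"
    by (rule pair_measure_closed)
  from Int_stable_pair_measure_generator this S[unfolded sets_eq]
  show ?thesis
  proof (induction rule: sigma_sets_induct_disjoint)
    case (basic T)
    then obtain a b where T: "T = a \<times> b" and a: "a \<in> sets F" and b: "b \<in> sets N"
      by auto
    have a': "a \<in> sets M"
      using a sub by (auto simp: subalgebra_def)
    have int: "integrable M (\<lambda>\<omega>. indicat_real b (Z \<omega>))"
      by (rule integrable_const_bound[where B=1])
        (use Z b in \<open>auto intro!: measurable_compose[OF Z] borel_measurable_indicator\<close>)
    have Kb: "(\<lambda>\<omega>. measure (K \<omega>) b) \<in> borel_measurable M"
      by (rule measurable_from_subalg[OF sub measurable_compose[OF
              Kmeas measurable_measure_prob_algebra[OF b]]])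
    have ae: "AE \<omega> in M. measure (K \<omega>) b = real_cond_exp M F (\<lambda>\<omega>'. indicat_real b (Z \<omega>')) \<omega>"
      using K b by (simp add: regular_cond_dist_def)
    have "prob {\<omega> \<in> space M. (\<omega>, Z \<omega>) \<in> T} = (\<integral>\<omega>\<in>a. indicat_real b (Z \<omega>) \<partial>M)"
    proof -
      have "(\<integral>\<omega>\<in>a. indicat_real b (Z \<omega>) \<partial>M)
          = (\<integral>\<omega>. indicat_real {\<omega> \<in> space M. (\<omega>, Z \<omega>) \<in> T} \<omega> \<partial>M)"
        unfolding set_lebesgue_integral_def T
        by (intro Bochner_Integration.integral_cong) (auto simp: indicator_def)
      also have "\<dots> = prob {\<omega> \<in> space M. (\<omega>, Z \<omega>) \<in> T}"
        by (simp add: Int_absorb2 subset_eq)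
      finally show ?thesis by simp
    qed
    \<comment> \<open>The averaging property applies because \<open>a\<close> belongs to
      \<open>F\<close>; the conditional expectation is then replaced by its version \<open>K\<close>
      outside a null set.\<close>
    also have "\<dots> = (\<integral>\<omega>\<in>a. real_cond_exp M F (\<lambda>\<omega>'. indicat_real b (Z \<omega>')) \<omega> \<partial>M)"
      by (rule real_cond_exp_intA[OF int a])
    also have "\<dots> = (\<integral>\<omega>. indicat_real a \<omega> * measure (K \<omega>) b \<partial>M)"
      unfolding set_lebesgue_integral_def
      by (rule integral_cong_AE) (use ae Kb a' in auto)
    finally have *: "prob {\<omega> \<in> space M. (\<omega>, Z \<omega>) \<in> T}
        = (\<integral>\<omega>. indicat_real a \<omega> * measure (K \<omega>) b \<partial>M)" .
    have int2: "integrable M (\<lambda>\<omega>. indicat_real a \<omega> * measure (K \<omega>) b)"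
      by (rule integrable_const_bound[where B=1])
        (use Kb a' prob_space.prob_le_1[OF Kprob] in \<open>auto simp: indicator_def\<close>)
    have "(\<integral>\<^sup>+\<omega>. emeasure (K \<omega>) (Pair \<omega> -` T) \<partial>M)
        = (\<integral>\<^sup>+\<omega>. ennreal (indicat_real a \<omega> * measure (K \<omega>) b) \<partial>M)"
    proof (rule nn_integral_cong)
      fix \<omega> assume "\<omega> \<in> space M"
      then interpret K: prob_space "K \<omega>" by (rule Kprob)
      show "emeasure (K \<omega>) (Pair \<omega> -` T) = ennreal (indicat_real a \<omega> * measure (K \<omega>) b)"
        unfolding T by (auto simp: indicator_def K.emeasure_eq_measure)
    qed
    also have "\<dots> = ennreal (\<integral>\<omega>. indicat_real a \<omega> * measure (K \<omega>) b \<partial>M)"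
      by (rule nn_integral_eq_integral[OF int2]) (auto simp: indicator_def)
    finally show ?case
      by (simp add: emeasure_eq_measure *)
  next
    case empty
    show ?case by simp
  next
    case (compl T)
    then have T: "T \<in> sets (F \<Otimes>\<^sub>M N)"
      by (simp add: sets_eq)
    have "emeasure M {\<omega> \<in> space M. (\<omega>, Z \<omega>) \<in> space F \<times> space N - T}
        = emeasure M (space M - {\<omega> \<in> space M. (\<omega>, Z \<omega>) \<in> T})"
      using measurable_space[OF Z] space_F by (intro arg_cong[where f="emeasure M"]) auto
    also have "\<dots> = 1 - emeasure M {\<omega> \<in> space M. (\<omega>, Z \<omega>) \<in> T}"
      using event[OF T] by (subst emeasure_compl) (auto simp: emeasure_space_1)
    also have "\<dots> = (\<integral>\<^sup>+\<omega>. 1 \<partial>M) - (\<integral>\<^sup>+\<omega>. emeasure (K \<omega>) (Pair \<omega> -` T) \<partial>M)"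
      using compl.IH by (simp add: emeasure_space_1)
    also have "\<dots> = (\<integral>\<^sup>+\<omega>. 1 - emeasure (K \<omega>) (Pair \<omega> -` T) \<partial>M)"
    proof (rule nn_integral_diff[symmetric])
      \<comment> \<open>Subtracting extended nonnegative integrals requires a finite subtrahend; by
        the induction hypothesis it is a probability.\<close>
      show "(\<integral>\<^sup>+\<omega>. emeasure (K \<omega>) (Pair \<omega> -` T) \<partial>M) \<noteq> \<infinity>"
        using compl.IH emeasure_finite by (metis infinity_ennreal_def)
      show "AE \<omega> in M. emeasure (K \<omega>) (Pair \<omega> -` T) \<le> 1"
        using prob_space.measure_le_1[OF Kprob] by (auto intro!: AE_I2)
    qed (use meas_slice[OF T] in auto)
    also have "\<dots> = (\<integral>\<^sup>+\<omega>. emeasure (K \<omega>) (Pair \<omega> -` (space F \<times> space N - T)) \<partial>M)"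
    proof (rule nn_integral_cong)
      fix \<omega> assume \<omega>: "\<omega> \<in> space M"
      then interpret K: prob_space "K \<omega>" by (rule Kprob)
      have "Pair \<omega> -` (space F \<times> space N - T) = space (K \<omega>) - Pair \<omega> -` T"
        using \<omega> space_F sets_eq_imp_space_eq[OF Ksets[OF \<omega>]] by auto
      then show "1 - emeasure (K \<omega>) (Pair \<omega> -` T)
          = emeasure (K \<omega>) (Pair \<omega> -` (space F \<times> space N - T))"
        using slice[OF T \<omega>] by (simp add: emeasure_compl K.emeasure_space_1)
    qed
    finally show ?case .
  next
    case (union T)
    then have T: "T i \<in> sets (F \<Otimes>\<^sub>M N)" for i
      by (auto simp: sets_eq)
    have "emeasure M {\<omega> \<in> space M. (\<omega>, Z \<omega>) \<in> (\<Union>i. T i)}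
        = emeasure M (\<Union>i. {\<omega> \<in> space M. (\<omega>, Z \<omega>) \<in> T i})"
      by (intro arg_cong[where f="emeasure M"]) auto
    also have "\<dots> = (\<Sum>i. emeasure M {\<omega> \<in> space M. (\<omega>, Z \<omega>) \<in> T i})"
      using event[OF T] union(1)
      by (intro suminf_emeasure[symmetric]) (auto simp: disjoint_family_on_def)
    also have "\<dots> = (\<Sum>i. \<integral>\<^sup>+\<omega>. emeasure (K \<omega>) (Pair \<omega> -` T i) \<partial>M)"
      using union.IH by simp
    also have "\<dots> = (\<integral>\<^sup>+\<omega>. (\<Sum>i. emeasure (K \<omega>) (Pair \<omega> -` T i)) \<partial>M)"
      using meas_slice[OF T] by (intro nn_integral_suminf[symmetric])
    also have "\<dots> = (\<integral>\<^sup>+\<omega>. emeasure (K \<omega>) (Pair \<omega> -` (\<Union>i. T i)) \<partial>M)"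
    proof (rule nn_integral_cong)
      fix \<omega> assume "\<omega> \<in> space M"
      moreover have "disjoint_family (\<lambda>i. Pair \<omega> -` T i)"
        using union(1) unfolding disjoint_family_on_def by blast
      ultimately show "(\<Sum>i. emeasure (K \<omega>) (Pair \<omega> -` T i))
          = emeasure (K \<omega>) (Pair \<omega> -` (\<Union>i. T i))"
        unfolding vimage_UN using slice[OF T] by (intro suminf_emeasure) auto
    qed
    finally show ?case .
  qed
qed

section \<open>A single estimation problem: risk and posterior mass of balls\<close>

context metric_estimation
begin

lemma subalgebra_sigma_gen: "subalgebra \<Omega> (sigma_gen \<Omega> B Y)"
  unfolding subalgebra_def sigma_gen_def
  using measurable_sets[OF Y(1)] measurable_space[OF Y(1)]
  by (auto simp: sets_vimage_algebra2 Pi_iff)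

lemma post_measurable: "post \<in> sigma_gen \<Omega> B Y \<rightarrow>\<^sub>M prob_algebra \<mu>"
  using posterior by (simp add: regular_cond_dist_def)

lemma prob_space_post: "\<omega> \<in> space \<Omega> \<Longrightarrow> prob_space (post \<omega>)"
  using measurable_space[OF post_measurable, of \<omega>]
  by (simp add: space_prob_algebra sigma_gen_def)

text \<open>The second coordinate is a free point of \<open>A\<close>, not
  \<open>X \<omega>\<close>, since the disintegration takes sets from the product of the algebra
  generated by \<open>Y\<close> with that of the prior. Here it matters that an estimator depends
  measurably on the data alone.\<close>

lemma dist_estimator_measurable:
  assumes "estimator \<Omega> B Y \<mu> xh"
  shows "(\<lambda>p. d (xh (fst p)) (snd p)) \<in> borel_measurable (sigma_gen \<Omega> B Y \<Otimes>\<^sub>M \<mu>)"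
proof -
  have [measurable]: "xh \<in> sigma_gen \<Omega> B Y \<rightarrow>\<^sub>M \<mu>"
    using assms by (simp add: estimator_def)
  have "(\<lambda>p. (xh (fst p), snd p)) \<in> sigma_gen \<Omega> B Y \<Otimes>\<^sub>M \<mu> \<rightarrow>\<^sub>M \<mu> \<Otimes>\<^sub>M \<mu>"
    by measurable
  from measurable_compose[OF this dist_measurable] show ?thesis by simp
qed

lemma ball_graph_sets:
  assumes "estimator \<Omega> B Y \<mu> xh"
  shows "{p \<in> space (sigma_gen \<Omega> B Y \<Otimes>\<^sub>M \<mu>). d (xh (fst p)) (snd p) \<le> r}
    \<in> sets (sigma_gen \<Omega> B Y \<Otimes>\<^sub>M \<mu>)"
  using dist_estimator_measurable[OF assms] by measurable

lemma estimator_in_space: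
  assumes "estimator \<Omega> B Y \<mu> xh" "\<omega> \<in> space \<Omega>"
  shows "xh \<omega> \<in> A"
  using measurable_space[of xh "sigma_gen \<Omega> B Y" \<mu> \<omega>] assms prior(2)
  by (simp add: estimator_def sigma_gen_def)

text \<open>This identifies the moving set of the disintegration with the ball around the estimate.
  Membership in \<open>mcball\<close> also asks for a centre in \<open>A\<close>, which holds for
  the values of an estimator.\<close>

lemma ball_graph_slice:
  assumes "estimator \<Omega> B Y \<mu> xh" "\<omega> \<in> space \<Omega>"
  shows "Pair \<omega> -` {p \<in> space (sigma_gen \<Omega> B Y \<Otimes>\<^sub>M \<mu>). d (xh (fst p)) (snd p) \<le> r}
    = mcball (xh \<omega>) r"
  using estimator_in_space[OF assms] assms(2)
  by (auto simp: prior(2) space_pair_measure sigma_gen_def)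

lemma measurable_post_ball:
  assumes "estimator \<Omega> B Y \<mu> xh"
  shows "(\<lambda>\<omega>. measure (post \<omega>) (mcball (xh \<omega>) r)) \<in> borel_measurable \<Omega>"
proof (rule measurable_from_subalg[OF subalgebra_sigma_gen],
    rule measure_measurable_subprob_algebra2)
  have "(SIGMA \<omega>:space (sigma_gen \<Omega> B Y). mcball (xh \<omega>) r)
      = {p \<in> space (sigma_gen \<Omega> B Y \<Otimes>\<^sub>M \<mu>). d (xh (fst p)) (snd p) \<le> r}"
    using estimator_in_space[OF assms]
    by (auto simp: prior(2) space_pair_measure sigma_gen_def)
  then show "(SIGMA \<omega>:space (sigma_gen \<Omega> B Y). mcball (xh \<omega>) r) \<in> sets (sigma_gen \<Omega> B Y \<Otimes>\<^sub>M \<mu>)"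
    using ball_graph_sets[OF assms] by simp
  show "post \<in> sigma_gen \<Omega> B Y \<rightarrow>\<^sub>M subprob_algebra \<mu>"
    by (rule measurable_prob_algebraD[OF post_measurable])
qed

lemma integrable_post_ball:
  assumes "estimator \<Omega> B Y \<mu> xh"
  shows "integrable \<Omega> (\<lambda>\<omega>. measure (post \<omega>) (mcball (xh \<omega>) r))"
  by (rule integrable_const_bound[where B=1])
    (use measurable_post_ball[OF assms] prob_space.prob_le_1[OF prob_space_post] in auto)

lemma dist_X_measurable:
  assumes "estimator \<Omega> B Y \<mu> xh"
  shows "(\<lambda>\<omega>. d (xh \<omega>) (X \<omega>)) \<in> borel_measurable \<Omega>"
proof -
  have "(\<lambda>\<omega>. (\<omega>, X \<omega>)) \<in> \<Omega> \<rightarrow>\<^sub>M sigma_gen \<Omega> B Y \<Otimes>\<^sub>M \<mu>"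
    using X(1) measurable_from_subalg[OF subalgebra_sigma_gen measurable_ident_sets[OF refl]]
    by (rule measurable_Pair[rotated])
  from measurable_compose[OF this dist_estimator_measurable[OF assms]] show ?thesis by simp
qed

lemma risk_eq:
  assumes "estimator \<Omega> B Y \<mu> xh"
  shows "risk d \<Omega> X r xh = 1 - (\<integral>\<omega>. measure (post \<omega>) (mcball (xh \<omega>) r) \<partial>\<Omega>)"
proof -
  let ?S = "{p \<in> space (sigma_gen \<Omega> B Y \<Otimes>\<^sub>M \<mu>). d (xh (fst p)) (snd p) \<le> r}"
  let ?H = "{\<omega> \<in> space \<Omega>. d (xh \<omega>) (X \<omega>) \<le> r}"
  have H: "?H \<in> sets \<Omega>"
    using dist_X_measurable[OF assms] by measurable
  \<comment> \<open>The success event \<open>?H\<close> says that the pair of the sample point and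
    \<open>X\<close> lies in \<open>?S\<close>, whose sections are the balls around the
    estimate.\<close>
  have "ennreal (prob ?H) = emeasure \<Omega> {\<omega> \<in> space \<Omega>. (\<omega>, X \<omega>) \<in> ?S}"
    unfolding emeasure_eq_measure[symmetric] using measurable_space[OF X(1)]
    by (intro arg_cong[where f="emeasure \<Omega>"]) (auto simp: space_pair_measure sigma_gen_def)
  also have "\<dots> = (\<integral>\<^sup>+\<omega>. emeasure (post \<omega>) (Pair \<omega> -` ?S) \<partial>\<Omega>)"
    by (rule emeasure_graph_regular_cond_dist[OF subalgebra_sigma_gen X(1) posterior
          ball_graph_sets[OF assms]])
  also have "\<dots> = (\<integral>\<^sup>+\<omega>. ennreal (measure (post \<omega>) (mcball (xh \<omega>) r)) \<partial>\<Omega>)"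
    by (intro nn_integral_cong)
      (simp only: ball_graph_slice[OF assms]
        finite_measure.emeasure_eq_measure[OF prob_space.finite_measure[OF prob_space_post]])
  also have "\<dots> = ennreal (\<integral>\<omega>. measure (post \<omega>) (mcball (xh \<omega>) r) \<partial>\<Omega>)"
    by (rule nn_integral_eq_integral[OF integrable_post_ball[OF assms]]) simp
  finally have prob_H: "prob ?H = (\<integral>\<omega>. measure (post \<omega>) (mcball (xh \<omega>) r) \<partial>\<Omega>)"
    by simp
  have "risk d \<Omega> X r xh = (\<integral>\<omega>. indicat_real (space \<Omega> - ?H) \<omega> \<partial>\<Omega>)"
    unfolding risk_def loss_def
    by (intro Bochner_Integration.integral_cong) (auto simp: indicator_def)
  also have "\<dots> = 1 - prob ?H"
    using H by (simp add: prob_compl Int_absorb2)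
  finally show ?thesis
    by (simp add: prob_H)
qed

text \<open>A larger tolerance forgives more errors. This lets estimators tuned to shrinking radii
  serve every fixed radius.\<close>

lemma risk_mono:
  assumes "estimator \<Omega> B Y \<mu> xh" "r \<le> s"
  shows "risk d \<Omega> X s xh \<le> risk d \<Omega> X r xh"
  unfolding risk_def
proof (rule integral_mono)
  have [measurable]: "(\<lambda>\<omega>. d (xh \<omega>) (X \<omega>)) \<in> borel_measurable \<Omega>"
    by (rule dist_X_measurable[OF assms(1)])
  have "integrable \<Omega> (\<lambda>\<omega>. loss d t (xh \<omega>) (X \<omega>))" for t
    unfolding loss_def by (rule integrable_const_bound[where B=1]) auto
  then show "integrable \<Omega> (\<lambda>\<omega>. loss d s (xh \<omega>) (X \<omega>))"
    "integrable \<Omega> (\<lambda>\<omega>. loss d r (xh \<omega>) (X \<omega>))"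
    by blast+
  show "loss d s (xh \<omega>) (X \<omega>) \<le> loss d r (xh \<omega>) (X \<omega>)" for \<omega>
    using assms(2) by (auto simp: loss_def of_bool_def)
qed

lemma risk_nonneg: "0 \<le> risk d \<Omega> X r xh"
  unfolding risk_def loss_def by simp

lemma measure_le_max_post:
  assumes "\<omega> \<in> space \<Omega>" "x \<in> A"
  shows "measure (post \<omega>) (mcball x r) \<le> max_post A d (post \<omega>) r"
  unfolding max_post_def
  by (rule cSUP_upper[OF assms(2)])
    (auto intro!: bdd_aboveI[of _ 1] prob_space.prob_le_1[OF prob_space_post[OF assms(1)]])

text \<open>Replaces a possibly uncountable supremum by the posterior mass of one measurably chosen
  ball; measurability, bounds and integrability of the maximum are all read off from it.\<close>

lemma max_post_attained:
  assumes "0 \<le> r"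
  obtains xs where "estimator \<Omega> B Y \<mu> xs"
    "\<And>\<omega>. \<omega> \<in> space \<Omega> \<Longrightarrow> max_post A d (post \<omega>) r = measure (post \<omega>) (mcball (xs \<omega>) r)"
proof -
  obtain xs where xs: "estimator \<Omega> B Y \<mu> xs"
    and max: "\<And>\<omega> x. \<omega> \<in> space \<Omega> \<Longrightarrow> x \<in> A \<Longrightarrow>
      measure (post \<omega>) (mcball x r) \<le> measure (post \<omega>) (mcball (xs \<omega>) r)"
    using max_attained[OF assms] by blast
  have "max_post A d (post \<omega>) r = measure (post \<omega>) (mcball (xs \<omega>) r)" if "\<omega> \<in> space \<Omega>" for \<omega>
  proof (rule antisym)
    show "max_post A d (post \<omega>) r \<le> measure (post \<omega>) (mcball (xs \<omega>) r)"
      unfolding max_post_def using max[OF that] estimator_in_space[OF xs that]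
      by (intro cSUP_least) auto
  qed (rule measure_le_max_post[OF that estimator_in_space[OF xs that]])
  then show thesis
    using that xs by blast
qed

lemma max_post_measurable:
  assumes "0 \<le> r"
  shows "(\<lambda>\<omega>. max_post A d (post \<omega>) r) \<in> borel_measurable \<Omega>"
proof -
  obtain xs where "estimator \<Omega> B Y \<mu> xs"
    "\<And>\<omega>. \<omega> \<in> space \<Omega> \<Longrightarrow> max_post A d (post \<omega>) r = measure (post \<omega>) (mcball (xs \<omega>) r)"
    using max_post_attained[OF assms] by blast
  then show ?thesis
    using measurable_post_ball[of xs r] by (simp cong: measurable_cong)
qed

lemma max_post_bounds:
  assumes "0 \<le> r" "\<omega> \<in> space \<Omega>"
  shows "0 \<le> max_post A d (post \<omega>) r" "max_post A d (post \<omega>) r \<le> 1"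
proof -
  obtain xs where "max_post A d (post \<omega>) r = measure (post \<omega>) (mcball (xs \<omega>) r)"
    using max_post_attained[OF assms(1)] assms(2) by blast
  then show "0 \<le> max_post A d (post \<omega>) r" "max_post A d (post \<omega>) r \<le> 1"
    using prob_space.prob_le_1[OF prob_space_post[OF assms(2)]] by simp_all
qed

lemma integrable_max_post:
  assumes "0 \<le> r"
  shows "integrable \<Omega> (\<lambda>\<omega>. max_post A d (post \<omega>) r)"
  by (rule integrable_const_bound[where B=1])
    (use max_post_measurable max_post_bounds assms in auto)

lemma risk_ge:
  assumes "0 \<le> r" "estimator \<Omega> B Y \<mu> xh"
  shows "1 - (\<integral>\<omega>. max_post A d (post \<omega>) r \<partial>\<Omega>) \<le> risk d \<Omega> X r xh"
proof -
  have "(\<integral>\<omega>. measure (post \<omega>) (mcball (xh \<omega>) r) \<partial>\<Omega>) \<le> (\<integral>\<omega>. max_post A d (post \<omega>) r \<partial>\<Omega>)"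
    by (rule integral_mono[OF integrable_post_ball[OF assms(2)] integrable_max_post[OF assms(1)]])
      (rule measure_le_max_post[OF _ estimator_in_space[OF assms(2)]])
  then show ?thesis
    by (simp add: risk_eq[OF assms(2)])
qed

lemma optimal_estimator:
  assumes "0 \<le> r"
  shows "\<exists>xs. estimator \<Omega> B Y \<mu> xs
    \<and> risk d \<Omega> X r xs = 1 - (\<integral>\<omega>. max_post A d (post \<omega>) r \<partial>\<Omega>)"
proof -
  obtain xs where xs: "estimator \<Omega> B Y \<mu> xs"
    "\<And>\<omega>. \<omega> \<in> space \<Omega> \<Longrightarrow> max_post A d (post \<omega>) r = measure (post \<omega>) (mcball (xs \<omega>) r)"
    using max_post_attained[OF assms] by blast
  have "(\<integral>\<omega>. max_post A d (post \<omega>) r \<partial>\<Omega>) = (\<integral>\<omega>. measure (post \<omega>) (mcball (xs \<omega>) r) \<partial>\<Omega>)"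
    by (rule Bochner_Integration.integral_cong) (auto simp: xs(2))
  then show ?thesis
    using xs(1) risk_eq[OF xs(1)] by auto
qed

end

section \<open>A diagonal choice of indices\<close>

text \<open>Let \<open>k n\<close> be the largest index up to \<open>n\<close> at which row
  \<open>n\<close> lies below \<open>1/(k+1)\<close>. Every fixed index qualifies for all large
  \<open>n\<close>, so \<open>k n\<close> tends to infinity, and the selected entry lies below a
  bound that itself tends to 0.\<close>

lemma diagonal_tendsto_zero:
  fixes R :: "nat \<Rightarrow> nat \<Rightarrow> real"
  assumes lim: "\<And>k. (\<lambda>n. R n k) \<longlonglongrightarrow> 0"
    and nonneg: "\<And>n k. 0 \<le> R n k"
  obtains k where "filterlim k at_top sequentially" "(\<lambda>n. R n (k n)) \<longlonglongrightarrow> 0"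
proof -
  \<comment> \<open>The default index 0 keeps the set nonempty when no index qualifies, and
    \<open>k \<le> n\<close> keeps it finite, so that \<open>Max\<close> is meaningful.\<close>
  define G where "G n = insert 0 {k. k \<le> n \<and> R n k < inverse (real (Suc k))}" for n
  define k where "k n = Max (G n)" for n
  have fin: "finite (G n)" for n
    unfolding G_def by auto
  have k_in: "k n \<in> G n" for n
    unfolding k_def by (rule Max_in[OF fin]) (auto simp: G_def)
  have top: "filterlim k at_top sequentially"
    unfolding filterlim_at_top
  proof
    fix m
    have "\<forall>\<^sub>F n in sequentially. R n m < inverse (real (Suc m))"
      by (rule order_tendstoD(2)[OF lim]) simp
    then show "\<forall>\<^sub>F n in sequentially. m \<le> k n"
      using eventually_ge_at_top[of m]
      by eventually_elim (auto simp: k_def G_def intro!: Max_ge)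
  qed
  have lim_inverse: "(\<lambda>n. inverse (real (Suc (k n)))) \<longlonglongrightarrow> 0"
    by (rule filterlim_compose[OF LIMSEQ_inverse_real_of_nat top])
  \<comment> \<open>Once \<open>k n \<ge> 1\<close>, the selected index is not the default, so the
    defining inequality holds for it.\<close>
  have le_inverse: "\<forall>\<^sub>F n in sequentially. R n (k n) \<le> inverse (real (Suc (k n)))"
    using filterlim_at_top[THEN iffD1, OF top, rule_format, of 1]
  proof eventually_elim
    case (elim n)
    then show ?case
      using k_in[of n] by (auto simp: G_def)
  qed
  have "(\<lambda>n. R n (k n)) \<longlonglongrightarrow> 0"
    by (rule tendsto_sandwich[OF _ le_inverse tendsto_const lim_inverse]) (simp add: nonneg)
  with top show thesis
    using that by blast
qed

section \<open>The four equivalences for a sequence of problems\<close>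

theorem corollary2p1:
  fixes A :: "nat \<Rightarrow> 'a set" and d :: "nat \<Rightarrow> 'a \<Rightarrow> 'a \<Rightarrow> real"
    and \<Omega> :: "nat \<Rightarrow> 'w measure" and \<mu> :: "nat \<Rightarrow> 'a measure" and B :: "nat \<Rightarrow> 'b measure"
    and \<nu> :: "nat \<Rightarrow> 'a \<Rightarrow> 'b measure" and X :: "nat \<Rightarrow> 'w \<Rightarrow> 'a" and Y :: "nat \<Rightarrow> 'w \<Rightarrow> 'b"
    and post :: "nat \<Rightarrow> 'w \<Rightarrow> 'a measure" and C :: "real \<Rightarrow> nat \<Rightarrow> 'w \<Rightarrow> real"
  assumes problem:
      "\<And>n. metric_estimation (A n) (d n) (\<Omega> n) (\<mu> n) (B n) (\<nu> n) (X n) (Y n) (post n)"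
    and C: "\<And>r n \<omega>. C r n \<omega> = max_post (A n) (d n) (post n \<omega>) r"
  shows "(partial_feasible d \<Omega> \<mu> B X Y \<longleftrightarrow> (\<exists>r. 0 \<le> r \<and> r < 1 \<and> tends_in_prob \<Omega> (C r) 1))
    \<and> (almost_exact_feasible d \<Omega> \<mu> B X Y \<longleftrightarrow> (\<forall>\<epsilon>>0. tends_in_prob \<Omega> (C \<epsilon>) 1))
    \<and> (partial_intractable d \<Omega> \<mu> B X Y \<longleftrightarrow> (\<forall>r. 0 \<le> r \<longrightarrow> r < 1 \<longrightarrow> tends_in_prob \<Omega> (C r) 0))
    \<and> (almost_exact_intractable d \<Omega> \<mu> B X Y \<longleftrightarrow> (\<exists>\<epsilon>>0. tends_in_prob \<Omega> (C \<epsilon>) 0))"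
proof -
  define m where "m r n = (\<integral>\<omega>. C r n \<omega> \<partial>\<Omega> n)" for r n
  let ?risk = "\<lambda>r xh n. risk (d n) (\<Omega> n) (X n) r (xh n)"
  have P: "prob_space (\<Omega> n)" for n
    using problem[of n] by (simp add: metric_estimation_def)
  have C_meas: "C r n \<in> borel_measurable (\<Omega> n)" if "0 \<le> r" for r n
    using metric_estimation.max_post_measurable[OF problem that] by (simp add: C[abs_def])
  have C_bounds: "0 \<le> C r n \<omega>" "C r n \<omega> \<le> 1" if "0 \<le> r" "\<omega> \<in> space (\<Omega> n)" for r n \<omega>
    using metric_estimation.max_post_bounds[OF problem that] by (simp_all add: C)
  have C_int: "integrable (\<Omega> n) (C r n)" if "0 \<le> r" for r n
    using metric_estimation.integrable_max_post[OF problem that] by (simp add: C[abs_def])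
  have risk_ge: "1 - m r n \<le> ?risk r xh n"
    if "0 \<le> r" "estimator_seq \<Omega> B Y \<mu> xh" for r xh n
    using metric_estimation.risk_ge[OF problem that(1)] that(2)
    by (simp add: m_def C estimator_seq_def)
  \<comment> \<open>The radius may vary with \<open>n\<close>: the diagonal argument for almost
    exact estimation needs this, and fixed radii are the constant case.\<close>
  have optimal: "\<exists>xs. \<forall>n. estimator (\<Omega> n) (B n) (Y n) (\<mu> n) (xs n)
      \<and> risk (d n) (\<Omega> n) (X n) (r n) (xs n) = 1 - m (r n) n" if "\<And>n. 0 \<le> r n" for r
    using metric_estimation.optimal_estimator[OF problem that]
    by (intro choice) (auto simp: m_def C)
  have optimal_fixed: "\<exists>xs. estimator_seq \<Omega> B Y \<mu> xs \<and> (\<forall>n. ?risk r xs n = 1 - m r n)"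
    if "0 \<le> r" for r
    using optimal[of "\<lambda>_. r"] that unfolding estimator_seq_def by blast
  \<comment> \<open>Nonnegativity of the optimal risk \<open>1 - m r n\<close>.\<close>
  have m_le_1: "m r n \<le> 1" if "0 \<le> r" for r n
  proof -
    obtain xs where "?risk r xs n = 1 - m r n"
      using optimal_fixed[OF \<open>0 \<le> r\<close>] by blast
    then show ?thesis
      using metric_estimation.risk_nonneg[OF problem[of n], of r "xs n"] by simp
  qed
  have risk_le_1: "?risk r xh n \<le> 1" if "estimator_seq \<Omega> B Y \<mu> xh" for r xh n
    using metric_estimation.risk_eq[OF problem, of n "xh n" r] that
    by (simp add: estimator_seq_def)
  have to_1: "tends_in_prob \<Omega> (C r) 1 \<longleftrightarrow> (\<lambda>n. 1 - m r n) \<longlonglongrightarrow> 0" if "0 \<le> r" for r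
  proof -
    have "(\<integral>\<omega>. \<bar>C r n \<omega> - 1\<bar> \<partial>\<Omega> n) = 1 - m r n" for n
    proof -
      interpret prob_space "\<Omega> n" by (rule P)
      have "(\<integral>\<omega>. \<bar>C r n \<omega> - 1\<bar> \<partial>\<Omega> n) = (\<integral>\<omega>. 1 - C r n \<omega> \<partial>\<Omega> n)"
        using C_bounds[OF that] by (intro Bochner_Integration.integral_cong) auto
      also have "\<dots> = 1 - m r n"
        using C_int[OF that]
        by (subst Bochner_Integration.integral_diff) (auto simp: m_def prob_space)
      finally show ?thesis .
    qed
    then show ?thesis
      using tends_in_prob_iff_integral_tendsto[of \<Omega> "C r" 1, OF P C_meas[OF that]] C_bounds[OF that]
      by (simp add: abs_le_iff)
  qed
  have to_0: "tends_in_prob \<Omega> (C r) 0 \<longleftrightarrow> m r \<longlonglongrightarrow> 0" if "0 \<le> r" for r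
  proof -
    have "(\<integral>\<omega>. \<bar>C r n \<omega> - 0\<bar> \<partial>\<Omega> n) = m r n" for n
      unfolding m_def using C_bounds[OF that] by (intro Bochner_Integration.integral_cong) auto
    then show ?thesis
      using tends_in_prob_iff_integral_tendsto[of \<Omega> "C r" 0, OF P C_meas[OF that]] C_bounds[OF that]
      by (simp add: abs_le_iff m_def[symmetric])
  qed
  \<comment> \<open>Squeeze \<open>0 \<le> 1 - m r n \<le>\<close> risk, at one fixed
    radius.\<close>
  have feasible_imp: "tends_in_prob \<Omega> (C r) 1"
    if "0 \<le> r" "estimator_seq \<Omega> B Y \<mu> xh" "?risk r xh \<longlonglongrightarrow> 0" for r xh
  proof -
    have "(\<lambda>n. 1 - m r n) \<longlonglongrightarrow> 0"
      by (rule tendsto_sandwich[OF _ _ tendsto_const that(3)])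
        (use m_le_1 risk_ge that in auto)
    then show ?thesis
      using to_1[OF that(1)] by simp
  qed
  \<comment> \<open>At a fixed radius, testing the optimal sequence gives one direction; for the
    other, every risk is squeezed between \<open>1 - m r n\<close> and 1. Both intractability
    equivalences then follow by quantifying over the radius.\<close>
  have intractable_iff: "(\<forall>xh. estimator_seq \<Omega> B Y \<mu> xh \<longrightarrow> ?risk r xh \<longlonglongrightarrow> 1)
      \<longleftrightarrow> tends_in_prob \<Omega> (C r) 0" if "0 \<le> r" for r
  proof (intro iffI allI impI)
    assume *: "\<forall>xh. estimator_seq \<Omega> B Y \<mu> xh \<longrightarrow> ?risk r xh \<longlonglongrightarrow> 1"
    obtain xs where xs: "estimator_seq \<Omega> B Y \<mu> xs" "\<And>n. ?risk r xs n = 1 - m r n"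
      using optimal_fixed[OF \<open>0 \<le> r\<close>] by blast
    have "(\<lambda>n. 1 - m r n) \<longlonglongrightarrow> 1"
      using * xs by auto
    from tendsto_diff[OF tendsto_const[of 1] this] have "m r \<longlonglongrightarrow> 0"
      by simp
    then show "tends_in_prob \<Omega> (C r) 0"
      using to_0[OF that] by simp
  next
    fix xh
    assume "tends_in_prob \<Omega> (C r) 0" and xh: "estimator_seq \<Omega> B Y \<mu> xh"
    then have "m r \<longlonglongrightarrow> 0"
      using to_0[OF that] by simp
    from tendsto_diff[OF tendsto_const[of 1] this] have "(\<lambda>n. 1 - m r n) \<longlonglongrightarrow> 1"
      by simp
    then show "?risk r xh \<longlonglongrightarrow> 1"
      by (rule tendsto_sandwich[OF _ _ _ tendsto_const, rotated 2])
        (use risk_ge[OF that xh] risk_le_1[OF xh] in auto)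
  qed
  have "partial_feasible d \<Omega> \<mu> B X Y \<longleftrightarrow> (\<exists>r. 0 \<le> r \<and> r < 1 \<and> tends_in_prob \<Omega> (C r) 1)"
  proof
    assume "partial_feasible d \<Omega> \<mu> B X Y"
    then show "\<exists>r. 0 \<le> r \<and> r < 1 \<and> tends_in_prob \<Omega> (C r) 1"
      unfolding partial_feasible_def using feasible_imp by blast
  next
    assume "\<exists>r. 0 \<le> r \<and> r < 1 \<and> tends_in_prob \<Omega> (C r) 1"
    then obtain r where r: "0 \<le> r" "r < 1" "(\<lambda>n. 1 - m r n) \<longlonglongrightarrow> 0"
      using to_1 by blast
    obtain xs where "estimator_seq \<Omega> B Y \<mu> xs" "\<And>n. ?risk r xs n = 1 - m r n"
      using optimal_fixed[OF r(1)] by blast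
    with r show "partial_feasible d \<Omega> \<mu> B X Y"
      unfolding partial_feasible_def by (intro exI[of _ r] exI[of _ xs]) simp
  qed
  moreover have "almost_exact_feasible d \<Omega> \<mu> B X Y \<longleftrightarrow> (\<forall>\<epsilon>>0. tends_in_prob \<Omega> (C \<epsilon>) 1)"
  proof
    assume "almost_exact_feasible d \<Omega> \<mu> B X Y"
    then show "\<forall>\<epsilon>>0. tends_in_prob \<Omega> (C \<epsilon>) 1"
      unfolding almost_exact_feasible_def using feasible_imp by (meson less_imp_le)
  next
    assume *: "\<forall>\<epsilon>>0. tends_in_prob \<Omega> (C \<epsilon>) 1"
    \<comment> \<open>A countable family of positive radii decreasing to 0, to which the diagonal
      choice applies.\<close>
    define e where "e k = inverse (real (Suc k))" for k
    have e_pos: "0 < e k" for k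
      by (simp add: e_def)
    have "(\<lambda>n. 1 - m (e k) n) \<longlonglongrightarrow> 0" for k
      using * to_1[of "e k"] e_pos[of k] by simp
    moreover have "0 \<le> 1 - m (e k) n" for n k
      using m_le_1[of "e k" n] e_pos[of k] by simp
    ultimately obtain k where k: "filterlim k at_top sequentially"
      and lim: "(\<lambda>n. 1 - m (e (k n)) n) \<longlonglongrightarrow> 0"
      using diagonal_tendsto_zero[of "\<lambda>n k. 1 - m (e k) n"] by blast
    \<comment> \<open>For each \<open>n\<close>, take an estimator optimal at the selected radius
      \<open>e (k n)\<close>.\<close>
    have "\<exists>xs. \<forall>n. estimator (\<Omega> n) (B n) (Y n) (\<mu> n) (xs n)
        \<and> risk (d n) (\<Omega> n) (X n) (e (k n)) (xs n) = 1 - m (e (k n)) n"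
      by (rule optimal) (rule less_imp_le[OF e_pos])
    then obtain xs where xs: "\<And>n. estimator (\<Omega> n) (B n) (Y n) (\<mu> n) (xs n)"
      and risk_xs: "\<And>n. risk (d n) (\<Omega> n) (X n) (e (k n)) (xs n) = 1 - m (e (k n)) n"
      by blast
    have "?risk \<epsilon> xs \<longlonglongrightarrow> 0" if "\<epsilon> > 0" for \<epsilon>
    proof (rule tendsto_sandwich[OF _ _ tendsto_const lim])
      \<comment> \<open>As soon as \<open>e (k n) < \<epsilon>\<close>, monotonicity bounds the risk
        at \<epsilon> by the risk at \<open>e (k n)\<close>, which tends to 0 by
        \<open>lim\<close>.\<close>
      have "(\<lambda>n. e (k n)) \<longlonglongrightarrow> 0"
        unfolding e_def by (rule filterlim_compose[OF LIMSEQ_inverse_real_of_nat k])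
      then have "\<forall>\<^sub>F n in sequentially. e (k n) < \<epsilon>"
        using that by (rule order_tendstoD)
      then show "\<forall>\<^sub>F n in sequentially. ?risk \<epsilon> xs n \<le> 1 - m (e (k n)) n"
        by eventually_elim
          (use metric_estimation.risk_mono[OF problem xs] risk_xs in \<open>metis less_imp_le\<close>)
    qed (auto intro!: always_eventually metric_estimation.risk_nonneg[OF problem])
    then show "almost_exact_feasible d \<Omega> \<mu> B X Y"
      unfolding almost_exact_feasible_def estimator_seq_def using xs by blast
  qed
  moreover have "partial_intractable d \<Omega> \<mu> B X Y
      \<longleftrightarrow> (\<forall>r. 0 \<le> r \<longrightarrow> r < 1 \<longrightarrow> tends_in_prob \<Omega> (C r) 0)"
    unfolding partial_intractable_def using intractable_iff by blast
  moreover have "almost_exact_intractable d \<Omega> \<mu> B X Y \<longleftrightarrow> (\<exists>\<epsilon>>0. tends_in_prob \<Omega> (C \<epsilon>) 0)"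
    unfolding almost_exact_intractable_def using intractable_iff by (meson less_imp_le)
  ultimately show ?thesis
    by blast
qed

end
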